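(* Let $(X,d)$ be a (not necessarily symmetric) metric space that has the convergence-symmetry property. Then a sequence in $X$ is forward Cauchy if and only if it is backward Cauchy.
   Context: A (not necessarily symmetric) metric space is a non-empty set $X$ with $d:X\times X\to[0,\infty)$ such that $d(x,y)=0$ iff $x=y$, and $d(x,y)+d(y,z)\ge d(x,z)$ for all $x,y,z$. It has the convergence-symmetry property if for any two sequences $(p_n)$, $(q_n)$ in $X$ with $d(p_n,q_n)\to0$ one also has $d(q_n,p_n)\to0$ as $n\to\infty$. A sequence $(x_i)$ is forward Cauchy if for every $\epsilon>0$ there is an integer $N$ such that $d(x_i,x_{i+k})<\epsilon$ for all $i\ge N$, $k\ge0$; it is backward Cauchy if for every $\epsilon>0$ there is $N$ such that $d(x_{i+k},x_i)<\epsilon$ for all $i\ge N$, $k\ge0$. *)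

theory Defs
  imports Complex_Main
begin

text \<open>Symmetry of the distance is not required, so the library's \<open>Metric_space\<close> does not apply.
  The values of \<open>d\<close> outside \<open>X\<close> are unconstrained and irrelevant.\<close>

locale asym_metric_space =
  fixes X :: "'a set" and d :: "'a \<Rightarrow> 'a \<Rightarrow> real"
  assumes nonempty: "X \<noteq> {}"
    and nonneg: "\<lbrakk>x \<in> X; y \<in> X\<rbrakk> \<Longrightarrow> 0 \<le> d x y"
    and zero_iff: "\<lbrakk>x \<in> X; y \<in> X\<rbrakk> \<Longrightarrow> d x y = 0 \<longleftrightarrow> x = y"
    and triangle: "\<lbrakk>x \<in> X; y \<in> X; z \<in> X\<rbrakk> \<Longrightarrow> d x z \<le> d x y + d y z"

definition convergence_symmetry :: "'a set \<Rightarrow> ('a \<Rightarrow> 'a \<Rightarrow> real) \<Rightarrow> bool" where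
  "convergence_symmetry X d \<longleftrightarrow>
     (\<forall>p q :: nat \<Rightarrow> 'a. (\<forall>n. p n \<in> X) \<longrightarrow> (\<forall>n. q n \<in> X) \<longrightarrow>
        (\<lambda>n. d (p n) (q n)) \<longlonglongrightarrow> 0 \<longrightarrow> (\<lambda>n. d (q n) (p n)) \<longlonglongrightarrow> 0)"

definition forward_Cauchy :: "('a \<Rightarrow> 'a \<Rightarrow> real) \<Rightarrow> (nat \<Rightarrow> 'a) \<Rightarrow> bool" where
  "forward_Cauchy d x \<longleftrightarrow> (\<forall>\<epsilon>>0. \<exists>N. \<forall>i\<ge>N. \<forall>k\<ge>0. d (x i) (x (i + k)) < \<epsilon>)"

definition backward_Cauchy :: "('a \<Rightarrow> 'a \<Rightarrow> real) \<Rightarrow> (nat \<Rightarrow> 'a) \<Rightarrow> bool" where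
  "backward_Cauchy d x \<longleftrightarrow> (\<forall>\<epsilon>>0. \<exists>N. \<forall>i\<ge>N. \<forall>k\<ge>0. d (x (i + k)) (x i) < \<epsilon>)"

end

theory Submission
  imports Defs
begin

text \<open>Convergence symmetry, although phrased with sequences, yields a uniform statement: how
  small \<open>d p q\<close> must be to force \<open>d q p < \<epsilon>\<close> does not depend on
  the points (\<open>convergence_symmetry_uniform\<close>). Both Cauchy conditions bound the
  distance between the same pairs of terms, in opposite directions, so uniformity carries each one
  over to the other.\<close>

lemma convergence_symmetry_uniform:
  fixes d :: "'a \<Rightarrow> 'a \<Rightarrow> real"
  assumes nonneg: "\<And>p q. \<lbrakk>p \<in> X; q \<in> X\<rbrakk> \<Longrightarrow> 0 \<le> d p q"
    and sym: "convergence_symmetry X d"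
    and "0 < \<epsilon>"
  shows "\<exists>\<delta>>0. \<forall>p\<in>X. \<forall>q\<in>X. d p q < \<delta> \<longrightarrow> d q p < \<epsilon>"
proof (rule ccontr)
  assume "\<not> ?thesis"
  then have "\<exists>p q. p \<in> X \<and> q \<in> X \<and> d p q < \<delta> \<and> \<epsilon> \<le> d q p" if "0 < \<delta>" for \<delta>
    using that by (meson not_le)
  \<comment> \<open>Counterexamples for \<open>\<delta> = 1/(n+1)\<close> form two sequences with
    \<open>d (p n) (q n)\<close> tending to 0 while the reversed distances stay at least
    \<open>\<epsilon>\<close>, against convergence symmetry.\<close>
  then have "\<forall>n. \<exists>p q. p \<in> X \<and> q \<in> X \<and> d p q < inverse (real (Suc n)) \<and> \<epsilon> \<le> d q p"
    by simp
  then obtain p q where pq: "\<And>n. p n \<in> X" "\<And>n. q n \<in> X"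
      "\<And>n. d (p n) (q n) < inverse (real (Suc n))" "\<And>n. \<epsilon> \<le> d (q n) (p n)"
    by metis
  have "(\<lambda>n. d (p n) (q n)) \<longlonglongrightarrow> 0"
    by (rule tendsto_sandwich[OF _ _ tendsto_const LIMSEQ_inverse_real_of_nat])
       (auto intro!: always_eventually nonneg pq less_imp_le[OF pq(3)] simp del: of_nat_Suc)
  then have "(\<lambda>n. d (q n) (p n)) \<longlonglongrightarrow> 0"
    using sym pq(1,2) unfolding convergence_symmetry_def by blast
  then have "\<epsilon> \<le> 0"
    by (rule LIMSEQ_le_const) (use pq(4) in blast)
  with \<open>0 < \<epsilon>\<close> show False by simp
qed

theorem lemma6p4:
  fixes X :: "'a set" and d :: "'a \<Rightarrow> 'a \<Rightarrow> real" and x :: "nat \<Rightarrow> 'a"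
  assumes "asym_metric_space X d"
    and "convergence_symmetry X d"
    and "\<And>n. x n \<in> X"
  shows "forward_Cauchy d x \<longleftrightarrow> backward_Cauchy d x"
proof -
  note * = convergence_symmetry_uniform[OF asym_metric_space.nonneg[OF assms(1)] assms(2)]
  show ?thesis
    unfolding forward_Cauchy_def backward_Cauchy_def
    \<comment> \<open>Given \<open>\<epsilon>\<close>, take \<open>\<delta>\<close> from
      \<open>*\<close>; the \<open>N\<close> that the assumed Cauchy condition gives for
      \<open>\<delta>\<close> serves for \<open>\<epsilon>\<close> in the other one.\<close>
    by (intro iffI allI impI; use * assms(3) in meson)
qed

end
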